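(* Let $p$ be a prime. The topological group $G=(\mathbb{Z},d_p)$ of all integers (under addition) with the topology of the $p$-adic metric $d_p$ is not orderly.
   Context: The interval topology of a linearly ordered set has as subbase all rays $\{x: a<x\}$, $\{x: x<b\}$. A compact linearly ordered space is a linearly ordered set whose interval topology is compact, equipped with that topology. $H_+(K)$ is the group of all order-preserving homeomorphisms $K\to K$ with the compact-open topology. A topological group is orderly if it embeds as a topological group (injective homomorphism, homeomorphism onto its image) into $H_+(K)$ for some compact linearly ordered space $K$. *)

theory Defs
  imports
    "HOL-Analysis.Analysis"
    "HOL-Algebra.Bij"
    "HOL-Algebra.Elementary_Groups"
    "HOL-Computational_Algebra.Primes"
begin

section \<open>Linearly ordered spaces\<close>

text \<open>
  A linearly ordered set is a carrier \<open>K\<close> with a reflexive order relation \<open>r\<close> such that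
  \<^term>\<open>linear_order_on K r\<close>. The set \<open>K\<close> itself is a generator of the interval topology: it is
  the empty intersection of subbasic sets, which is not covered by rays if \<open>K\<close> has one point.
\<close>

definition interval_topology :: "'k set \<Rightarrow> 'k rel \<Rightarrow> 'k topology" where
  "interval_topology K r = topology_generated_by
     (insert K ({{x \<in> K. (a, x) \<in> r \<and> a \<noteq> x} | a. a \<in> K}
              \<union> {{x \<in> K. (x, b) \<in> r \<and> x \<noteq> b} | b. b \<in> K}))"

lemma topspace_interval_topology [simp]: "topspace (interval_topology K r) = K"
  by (auto simp: interval_topology_def)

definition compact_linearly_ordered_space :: "'k set \<Rightarrow> 'k rel \<Rightarrow> bool" where
  "compact_linearly_ordered_space K r \<longleftrightarrow>
     linear_order_on K r \<and> compact_space (interval_topology K r)"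


section \<open>The group of order-preserving homeomorphisms\<close>

definition compact_open_topology ::
    "'a topology \<Rightarrow> 'b topology \<Rightarrow> ('a \<Rightarrow> 'b) set \<Rightarrow> ('a \<Rightarrow> 'b) topology" where
  "compact_open_topology X Y F =
     topology_generated_by {{f \<in> F. f ` C \<subseteq> U} | C U. compactin X C \<and> openin Y U}"

lemma topspace_compact_open_topology [simp]: "topspace (compact_open_topology X Y F) = F"
proof -
  have "{f \<in> F. f ` {} \<subseteq> {}} \<in> {{f \<in> F. f ` C \<subseteq> U} | C U. compactin X C \<and> openin Y U}"
    by (intro CollectI exI[of _ "{}"]) auto
  then show ?thesis
    unfolding compact_open_topology_def by auto
qed

text \<open>
  Self-maps of \<open>K\<close> are represented by extensional functions, so that the maps \<open>K \<rightarrow> K\<close>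
  correspond to unique elements of the function type; multiplication is composition.
\<close>

definition H_plus :: "'k set \<Rightarrow> 'k rel \<Rightarrow> ('k \<Rightarrow> 'k) monoid" where
  "H_plus K r = (BijGroup K)
     \<lparr>carrier := {f \<in> Bij K.
        homeomorphic_map (interval_topology K r) (interval_topology K r) f \<and>
        monotone_on K (\<lambda>x y. (x, y) \<in> r) (\<lambda>x y. (x, y) \<in> r) f}\<rparr>"

definition H_plus_topology :: "'k set \<Rightarrow> 'k rel \<Rightarrow> ('k \<Rightarrow> 'k) topology" where
  "H_plus_topology K r =
     compact_open_topology (interval_topology K r) (interval_topology K r) (carrier (H_plus K r))"

lemma group_H_plus:
  assumes "linear_order_on K r"
  shows "group (H_plus K r)"
proof -
  interpret B: group "BijGroup K" by (rule group_BijGroup)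
  let ?X = "interval_topology K r"
  have sub: "subgroup (carrier (H_plus K r)) (BijGroup K)"
  proof (rule B.subgroupI)
    show "carrier (H_plus K r) \<subseteq> carrier (BijGroup K)"
      by (auto simp: H_plus_def BijGroup_def)
    have "homeomorphic_map ?X ?X (\<lambda>x\<in>K. x)"
      using homeomorphic_map_id[of ?X ?X] by (subst homeomorphic_map_eq[of ?X ?X id]) auto
    then have "(\<lambda>x\<in>K. x) \<in> carrier (H_plus K r)"
      by (auto simp: H_plus_def id_Bij monotone_on_def)
    then show "carrier (H_plus K r) \<noteq> {}" by blast
  next
    fix f assume f: "f \<in> carrier (H_plus K r)"
    then have bij: "f \<in> Bij K" and hom: "homeomorphic_map ?X ?X f"
      and mono: "\<And>x y. x \<in> K \<Longrightarrow> y \<in> K \<Longrightarrow> (x, y) \<in> r \<Longrightarrow> (f x, f y) \<in> r"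
      by (auto simp: H_plus_def monotone_on_def)
    have bb: "bij_betw f K K" using bij by (simp add: Bij_def)
    obtain g where g: "homeomorphic_maps ?X ?X f g"
      using hom homeomorphic_map_maps by blast
    have "homeomorphic_map ?X ?X g"
      using g homeomorphic_maps_sym homeomorphic_map_maps by blast
    moreover have "g x = (\<lambda>x\<in>K. inv_into K f x) x" if "x \<in> topspace ?X" for x
    proof -
      have "g x \<in> K" "f (g x) = x"
        using g that by (auto simp: homeomorphic_maps_def continuous_map_def)
      then show ?thesis
        using that bb by (auto simp: bij_betw_def inv_into_f_eq)
    qed
    ultimately have h: "homeomorphic_map ?X ?X (\<lambda>x\<in>K. inv_into K f x)"
      using homeomorphic_map_eq by blast
    have m: "(inv_into K f x, inv_into K f y) \<in> r" if xy: "x \<in> K" "y \<in> K" "(x, y) \<in> r" for x y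
    proof -
      let ?a = "inv_into K f x" and ?b = "inv_into K f y"
      have ab: "?a \<in> K" "?b \<in> K" "f ?a = x" "f ?b = y"
        using bb xy by (auto simp: bij_betw_def inv_into_into f_inv_into_f)
      show ?thesis
      proof (rule ccontr)
        assume n: "(?a, ?b) \<notin> r"
        with assms ab have "(?b, ?a) \<in> r"
          by (metis linear_order_on_def partial_order_onD(1) refl_onD total_on_def)
        then have "(y, x) \<in> r" using mono ab by metis
        then have "x = y"
          using xy assms by (meson antisymD linear_order_on_def partial_order_onD(3))
        then show False
          using n ab assms by (metis linear_order_on_def partial_order_onD(1) refl_onD)
      qed
    qed
    show "inv\<^bsub>BijGroup K\<^esub> f \<in> carrier (H_plus K r)"
      using h m bij by (auto simp: inv_BijGroup H_plus_def restrict_inv_into_Bij monotone_on_def)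
  next
    fix f g assume fg: "f \<in> carrier (H_plus K r)" "g \<in> carrier (H_plus K r)"
    then have bij: "f \<in> Bij K" "g \<in> Bij K" by (auto simp: H_plus_def)
    have gK: "g x \<in> K" if "x \<in> K" for x
      using bij that Bij_imp_funcset by blast
    have "homeomorphic_map ?X ?X (f \<circ> g)"
      using fg by (auto simp: H_plus_def intro: homeomorphic_map_compose)
    then have "homeomorphic_map ?X ?X (compose K f g)"
      by (rule homeomorphic_map_eq) (simp add: compose_def)
    moreover have "monotone_on K (\<lambda>x y. (x, y) \<in> r) (\<lambda>x y. (x, y) \<in> r) (compose K f g)"
      using fg gK by (auto simp: H_plus_def monotone_on_def compose_def)
    ultimately show "f \<otimes>\<^bsub>BijGroup K\<^esub> g \<in> carrier (H_plus K r)"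
      using bij by (simp add: H_plus_def BijGroup_def compose_Bij)
  qed
  then have "group ((BijGroup K)\<lparr>carrier := carrier (H_plus K r)\<rparr>)"
    by (rule subgroup.subgroup_is_group) (rule group_BijGroup)
  then show ?thesis by (simp add: H_plus_def)
qed


section \<open>Orderly topological groups\<close>

locale topological_group = group G for G (structure) +
  fixes T :: "'a topology"
  assumes topspace_eq: "topspace T = carrier G"
    and continuous_mult: "continuous_map (prod_topology T T) T (\<lambda>(x, y). x \<otimes> y)"
    and continuous_inv: "continuous_map T T (\<lambda>x. inv x)"

text \<open>
  HOL cannot quantify over all types inside a formula, so the type from which the points
  of \<open>K\<close> are taken is a parameter. A topological group is orderly if \<open>orderly TYPE('k) G T\<close> holds
  for some type \<open>'k\<close>, and not orderly if it fails for every type \<open>'k\<close>, that is,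
  for a type variable.
\<close>

definition orderly :: "'k itself \<Rightarrow> ('a, 'm) monoid_scheme \<Rightarrow> 'a topology \<Rightarrow> bool" where
  "orderly (_ :: 'k itself) G T \<longleftrightarrow>
     (\<exists>(K :: 'k set) r \<phi>. compact_linearly_ordered_space K r \<and>
        \<phi> \<in> hom G (H_plus K r) \<and> inj_on \<phi> (carrier G) \<and>
        embedding_map T (H_plus_topology K r) \<phi>)"


section \<open>The integers with the p-adic metric\<close>

definition padic_dist :: "nat \<Rightarrow> int \<Rightarrow> int \<Rightarrow> real" where
  "padic_dist p x y = (if x = y then 0 else (1 / real p) ^ multiplicity (int p) (x - y))"

lemma padic_dist_ultra:
  assumes "prime p"
  shows "padic_dist p x z \<le> max (padic_dist p x y) (padic_dist p y z)"
proof (cases "x = y \<or> y = z \<or> x = z")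
  case True
  then show ?thesis by (auto simp: padic_dist_def max_def)
next
  case False
  let ?m = "multiplicity (int p)"
  let ?k = "min (?m (x - y)) (?m (y - z))"
  have p: "\<not> is_unit (int p)" using prime_gt_1_nat[OF assms] by simp
  have "int p ^ ?k dvd x - y" "int p ^ ?k dvd y - z"
    by (auto intro: multiplicity_dvd')
  then have "int p ^ ?k dvd (x - y) + (y - z)" by (rule dvd_add)
  then have "int p ^ ?k dvd x - z" by simp
  then have k: "?k \<le> ?m (x - z)"
    using False p by (intro multiplicity_geI) auto
  have "1 / real p \<le> 1" using assms prime_gt_1_nat[of p] by simp
  with k have "(1 / real p) ^ ?m (x - z) \<le> (1 / real p) ^ ?k"
    by (intro power_decreasing) auto
  also have "\<dots> \<le> max ((1 / real p) ^ ?m (x - y)) ((1 / real p) ^ ?m (y - z))"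
    by (auto simp: min_def)
  finally show ?thesis using False by (simp add: padic_dist_def)
qed

lemma padic_dist_nonneg: "0 \<le> padic_dist p x y"
  by (simp add: padic_dist_def)

lemma multiplicity_diff_commute: "multiplicity q (x - y) = multiplicity q (y - x)" for q x y :: int
  using multiplicity_times_unit_right[of "-1" q "x - y"] by simp

lemma padic_dist_commute: "padic_dist p x y = padic_dist p y x"
  by (simp add: padic_dist_def multiplicity_diff_commute[of _ x y])

lemma Metric_space_padic:
  assumes "prime p"
  shows "Metric_space UNIV (padic_dist p)"
proof
  fix x y z :: int
  show "padic_dist p x y = 0 \<longleftrightarrow> x = y"
    using assms by (auto simp: padic_dist_def prime_gt_0_nat)
  show "padic_dist p x z \<le> padic_dist p x y + padic_dist p y z"
    using padic_dist_ultra[OF assms, of x z y] padic_dist_nonneg[of p x y] padic_dist_nonneg[of p y z]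
    by linarith
qed (auto simp: padic_dist_nonneg padic_dist_commute)

definition padic_int_topology :: "nat \<Rightarrow> int topology" where
  "padic_int_topology p = Metric_space.mtopology UNIV (padic_dist p)"

lemma topological_group_padic_int:
  assumes "prime p"
  shows "topological_group integer_group (padic_int_topology p)"
proof -
  interpret M: Metric_space UNIV "padic_dist p" by (rule Metric_space_padic[OF assms])
  have minus: "padic_dist p (- x) (- y) = padic_dist p x y" for x y
    using multiplicity_diff_commute[of "int p" x y] by (auto simp: padic_dist_def)
  have shift: "padic_dist p (x + z) (y + z) = padic_dist p x y"
    "padic_dist p (z + x) (z + y) = padic_dist p x y" for x y z
    by (simp_all add: padic_dist_def)
  have plus: "padic_dist p (x + y) (x' + y') < e"
    if "padic_dist p x x' < e" "padic_dist p y y' < e" for x y x' y' e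
    using padic_dist_ultra[OF assms, of "x + y" "x' + y'" "x' + y"] that
    unfolding shift by linarith
  have open_iff: "openin M.mtopology U \<longleftrightarrow>
      (\<forall>x\<in>U. \<exists>e>0. \<forall>y. padic_dist p x y < e \<longrightarrow> y \<in> U)" for U
    by (auto simp: M.openin_mtopology M.mball_def subset_iff)
  have "continuous_map (prod_topology M.mtopology M.mtopology) M.mtopology (\<lambda>(x, y). x + y)"
    unfolding continuous_map_def
  proof safe
    fix U assume U: "openin M.mtopology U"
    show "openin (prod_topology M.mtopology M.mtopology)
       {z \<in> topspace (prod_topology M.mtopology M.mtopology). (case z of (x, y) \<Rightarrow> x + y) \<in> U}"
      unfolding openin_prod_topology_alt
    proof (intro allI impI)
      fix x y
      assume "(x, y) \<in> {z \<in> topspace (prod_topology M.mtopology M.mtopology).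
          (case z of (x, y) \<Rightarrow> x + y) \<in> U}"
      then obtain e where "e > 0" and e: "\<And>z. padic_dist p (x + y) z < e \<Longrightarrow> z \<in> U"
        using U open_iff by auto
      then show "\<exists>V W. openin M.mtopology V \<and> openin M.mtopology W \<and> x \<in> V \<and> y \<in> W \<and>
          V \<times> W \<subseteq> {z \<in> topspace (prod_topology M.mtopology M.mtopology).
          (case z of (x, y) \<Rightarrow> x + y) \<in> U}"
        by (intro exI[of _ "M.mball x e"] exI[of _ "M.mball y e"]) (auto intro!: e plus)
    qed
  qed auto
  moreover have "continuous_map M.mtopology M.mtopology (\<lambda>x. - x)"
    unfolding continuous_map_def open_iff by (auto, metis minus)
  ultimately show ?thesis
    by (intro topological_group.intro topological_group_axioms.intro)
      (simp_all add: padic_int_topology_def)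
qed

end

theory Submission
  imports Defs
begin

text \<open>
  If \<open>f\<close> is order preserving and \<open>x < f x\<close>, then \<open>x < f x \<le> f\<^sup>m x\<close> for all
  \<open>m \<ge> 1\<close>, so no positive power of \<open>f\<close> lies in the neighbourhood of the identity
  consisting of all \<open>g\<close> with \<open>g x < f x\<close>. But the multiples of \<open>p\<^sup>n\<close> tend to \<open>0\<close> \<open>p\<close>-adically.
\<close>

lemma padic_open_contains_multiples:
  assumes "prime p" and "openin (padic_int_topology p) W" and "0 \<in> W"
  obtains n where "\<And>k. k * int p ^ n \<in> W"
proof -
  interpret M: Metric_space UNIV "padic_dist p" by (rule Metric_space_padic[OF assms(1)])
  obtain e where "e > 0" and e: "M.mball 0 e \<subseteq> W"
    using assms(2,3) by (auto simp: padic_int_topology_def M.openin_mtopology)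
  have p: "p > 1" using prime_gt_1_nat[OF assms(1)] .
  \<comment> \<open>A nonzero multiple of \<open>p ^ n\<close> has multiplicity at least
    \<open>n\<close>, hence distance at most \<open>(1 / real p) ^ n\<close> from 0; so this
    \<open>n\<close> serves all \<open>k\<close> at once.\<close>
  obtain n where n: "(1 / real p) ^ n < e"
    using real_arch_pow_inv[OF \<open>e > 0\<close>, of "1 / real p"] p by auto
  have "padic_dist p 0 (k * int p ^ n) < e" for k
  \<comment> \<open>The multiplicity of 0 is 0 by convention, so the estimate applies only to
    \<open>k\<close> different from 0; for \<open>k = 0\<close> the distance is 0 outright.\<close>
  proof (cases "k = 0")
    case False
    with p have "n \<le> multiplicity (int p) (0 - k * int p ^ n)"
      by (intro multiplicity_geI) auto
    then have "(1 / real p) ^ multiplicity (int p) (0 - k * int p ^ n) \<le> (1 / real p) ^ n"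
      using p by (intro power_decreasing) auto
    with n \<open>e > 0\<close> show ?thesis by (simp add: padic_dist_def)
  qed (use \<open>e > 0\<close> in \<open>simp add: padic_dist_def\<close>)
  with e that show ?thesis by (auto simp: M.mball_def subset_iff)
qed

lemma H_plus_mult_apply:
  assumes "f \<in> carrier (H_plus K r)" "g \<in> carrier (H_plus K r)" "x \<in> K"
  shows "(f \<otimes>\<^bsub>H_plus K r\<^esub> g) x = f (g x)"
  using assms by (simp add: H_plus_def BijGroup_def compose_def)

text \<open>Singletons are compact and the ray below \<open>b\<close> is open, so this is a subbasic
  set of the compact-open topology.\<close>

lemma openin_H_plus_point_below:
  assumes "x \<in> K" "b \<in> K"
  shows "openin (H_plus_topology K r) {f \<in> carrier (H_plus K r). f x \<in> {y \<in> K. (y, b) \<in> r \<and> y \<noteq> b}}"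
proof -
  let ?X = "interval_topology K r" and ?U = "{y \<in> K. (y, b) \<in> r \<and> y \<noteq> b}"
  have "openin ?X ?U"
    unfolding interval_topology_def using assms(2)
    by (intro topology_generated_by_Basis) blast
  moreover have "compactin ?X {x}"
    using assms(1) by (simp add: compactin_sing)
  ultimately have "openin (H_plus_topology K r) {f \<in> carrier (H_plus K r). f ` {x} \<subseteq> ?U}"
    unfolding H_plus_topology_def compact_open_topology_def
    by (intro topology_generated_by_Basis) blast
  then show ?thesis by simp
qed

text \<open>Applying the monotone map \<phi>\<open>(int (Suc m) * k)\<close> to the inequality
  between \<open>x\<close> and its image under \<phi>\<open>k\<close> gives the next link of an
  increasing chain. The multiplier starts at 1, where the bound is reflexivity.\<close>

lemma hom_integer_group_H_plus_increasing:
  assumes r: "linear_order_on K r" and \<phi>: "\<phi> \<in> hom integer_group (H_plus K r)"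
    and x: "x \<in> K" "(x, \<phi> k x) \<in> r"
  shows "(\<phi> k x, \<phi> (int (Suc m) * k) x) \<in> r"
proof -
  have car: "\<phi> a \<in> carrier (H_plus K r)" for a
    using \<phi> by (auto simp: hom_def)
  have "\<phi> a \<in> K \<rightarrow> K" for a
    using car[of a] Bij_imp_funcset by (fastforce simp: H_plus_def)
  then have K: "\<phi> a y \<in> K" if "y \<in> K" for a y
    using that by blast
  have mono: "(\<phi> a y, \<phi> a z) \<in> r" if "(y, z) \<in> r" "y \<in> K" "z \<in> K" for a y z
    using car[of a] that by (auto simp: H_plus_def monotone_on_def)
  have add: "\<phi> (a + b) x = \<phi> a (\<phi> b x)" for a b
    using hom_mult[OF \<phi>, of a b] H_plus_mult_apply[OF car car x(1)] by simp
  show ?thesis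
  proof (induction m)
    case 0
    show ?case
      using r K[OF x(1)] by (simp add: linear_order_on_def partial_order_on_def preorder_on_def refl_on_def)
  next
    case (Suc m)
    have "\<phi> (int (Suc (Suc m)) * k) x = \<phi> (int (Suc m) * k) (\<phi> k x)"
      using add[of "int (Suc m) * k" k] by (simp add: algebra_simps)
    then have "(\<phi> (int (Suc m) * k) x, \<phi> (int (Suc (Suc m)) * k) x) \<in> r"
      using mono[OF x(2) x(1)] K x(1) by simp
    with Suc show ?case
      using r by (meson linear_order_on_def partial_order_onD(2) transD)
  qed
qed

theorem corollary4p5:
  fixes p :: nat
  assumes "prime p"
  shows "\<not> orderly TYPE('k) integer_group (padic_int_topology p)"
proof
  assume "orderly TYPE('k) integer_group (padic_int_topology p)"
  then obtain K :: "'k set" and r \<phi> where lin: "linear_order_on K r"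
    and \<phi>: "\<phi> \<in> hom integer_group (H_plus K r)" and inj: "inj \<phi>"
    and emb: "embedding_map (padic_int_topology p) (H_plus_topology K r) \<phi>"
    unfolding orderly_def compact_linearly_ordered_space_def by auto
  interpret M: Metric_space UNIV "padic_dist p" by (rule Metric_space_padic[OF assms])
  have car: "\<phi> a \<in> carrier (H_plus K r)" for a
    using \<phi> by (auto simp: hom_def)
  then have bij: "\<phi> a \<in> Bij K" for a
    by (simp add: H_plus_def)
  then have K: "\<phi> a x \<in> K" if "x \<in> K" for a x
    using that Bij_imp_funcset by blast
  have add: "\<phi> (a + b) x = \<phi> a (\<phi> b x)" if "x \<in> K" for a b x
    using hom_mult[OF \<phi>, of a b] H_plus_mult_apply[OF car car that] by simp
  \<comment> \<open>From \<open>0 + 0 = 0\<close>, the map \<phi>\<open>0\<close> is idempotent;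
    being injective on \<open>K\<close>, it fixes every point.\<close>
  have zero: "\<phi> 0 x = x" if "x \<in> K" for x
    using add[OF that, of 0 0] bij[of 0] K[OF that, of 0] that
    by (auto simp: Bij_def bij_betw_def inj_on_def)
  \<comment> \<open>Otherwise \<phi>\<open>1\<close> and \<phi>\<open>0\<close> agree on
    \<open>K\<close>, and by extensionality everywhere, against injectivity of \<phi>.\<close>
  obtain x where x: "x \<in> K" "\<phi> 1 x \<noteq> x"
  proof (rule ccontr)
    assume "\<not> thesis"
    then have "\<phi> 1 = \<phi> 0"
      using that zero Bij_imp_extensional[OF bij] by (metis extensionalityI)
    then show False using inj by (simp add: inj_eq)
  qed
  have inv: "\<phi> (- 1) (\<phi> 1 x) = x"
    using add[OF x(1), of "- 1" 1] zero[OF x(1)] by simp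
  \<comment> \<open>Here \<open>k\<close> is 1 or -1: if \<phi>\<open>1\<close> moves
    \<open>x\<close> down, its inverse \<phi>\<open>(- 1)\<close> moves \<open>x\<close> up.\<close>
  obtain k where k: "(x, \<phi> k x) \<in> r" "\<phi> k x \<noteq> x"
  proof (cases "(x, \<phi> 1 x) \<in> r")
    case True
    then show ?thesis using that x(2) by blast
  next
    case False
    then have "(\<phi> 1 x, x) \<in> r"
      using lin x K by (metis linear_order_on_def total_on_def)
    then have "(\<phi> (- 1) (\<phi> 1 x), \<phi> (- 1) x) \<in> r"
      using car[of "- 1"] x(1) K by (auto simp: H_plus_def monotone_on_def)
    moreover have "\<phi> (- 1) x \<noteq> x"
      using add[OF x(1), of 1 "- 1"] zero[OF x(1)] x(2) by auto
    ultimately show ?thesis using that inv by metis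
  qed
  \<comment> \<open>This contains \<phi>\<open>0\<close> because \<open>x\<close> lies strictly
    below its image under \<phi>\<open>k\<close>; its preimage under \<phi> is therefore an open set
    around 0.\<close>
  let ?V = "{f \<in> carrier (H_plus K r). f x \<in> {y \<in> K. (y, \<phi> k x) \<in> r \<and> y \<noteq> \<phi> k x}}"
  have "continuous_map (padic_int_topology p) (H_plus_topology K r) \<phi>"
    using emb by (auto simp: embedding_map_def continuous_map_in_subtopology
        dest: homeomorphic_imp_continuous_map)
  then have "openin (padic_int_topology p) {a \<in> topspace (padic_int_topology p). \<phi> a \<in> ?V}"
    using openin_H_plus_point_below[OF x(1) K[OF x(1)]] by (rule openin_continuous_map_preimage)
  then have "openin (padic_int_topology p) {a. \<phi> a \<in> ?V}"
    by (simp add: padic_int_topology_def)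
  moreover have "0 \<in> {a. \<phi> a \<in> ?V}"
    using car zero[OF x(1)] x(1) k by simp
  ultimately obtain n where n: "\<And>a. a * int p ^ n \<in> {a. \<phi> a \<in> ?V}"
    using padic_open_contains_multiples[OF assms] by blast
  have "p ^ n > 0" using assms prime_gt_0_nat by simp
  \<comment> \<open>Positivity of \<open>p ^ n\<close> makes \<open>k * int p ^ n\<close> a positive
    multiple of \<open>k\<close>, so the chain bound contradicts membership in
    \<open>?V\<close>.\<close>
  then obtain m where m: "p ^ n = Suc m" using gr0_conv_Suc by blast
  then have "int (Suc m) * k = k * int p ^ n"
    by (metis mult.commute of_nat_power)
  then have "(\<phi> k x, \<phi> (k * int p ^ n) x) \<in> r"
    using hom_integer_group_H_plus_increasing[OF lin \<phi> x(1) k(1), of m] by metis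
  moreover have "(\<phi> (k * int p ^ n) x, \<phi> k x) \<in> r" "\<phi> (k * int p ^ n) x \<noteq> \<phi> k x"
    using n[of k] by auto
  ultimately show False
    using lin by (meson antisymD linear_order_on_def partial_order_onD(3))
qed

end
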